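(* Let $n\ge1$ be an integer and let $\varphi\in\mathcal{LP}'$ with $\varphi(0)=1$. If $s,t\in\mathbb{R}$ are such that $|s|\le|t|$ and $st\ge0$, then $\varphi(sD)[P]\preccurlyeq\varphi(tD)[P]$ for every $P\in\mathcal{H}_n$.
   Context: $\mathcal{LP}'$ is the class of entire functions of the form $\varphi(x)=cx^me^{-a^2x^2}\prod_{k=1}^\infty(1-\alpha_kx)e^{\alpha_kx}$ with $a,c,\alpha_k\in\mathbb{R}$, $c\ne0$, $m$ a nonnegative integer and $\sum_k\alpha_k^2<\infty$. With $D=d/dx$ and $\varphi(x)=\sum_ka_kx^k$, put $\varphi(sD)[P]=\sum_ka_ks^kP^{(k)}$ for polynomials $P$. $\mathcal{H}_n$ denotes the set of monic univariate polynomials of degree $n$ all of whose zeros are real; $\mathcal{Z}(P)$ is the unordered tuple of zeros of $P$ counted with multiplicity. Spectral order: for unordered real $n$-tuples $X,Y$ write $X\prec Y$ if $\sum_{i=1}^n f(x_i)\le\sum_{i=1}^n f(y_i)$ for every convex $f:\mathbb{R}\to\mathbb{R}$ (equivalently, $X=AY$ as column vectors for some doubly stochastic matrix $A$); for $P,Q\in\mathcal{H}_n$ write $Q\preccurlyeq P$ if $\mathcal{Z}(Q)\prec\mathcal{Z}(P)$. (The polynomials in the claim lie in $\mathcal{H}_n$ by a classical theorem of Pólya.) *)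

theory Defs
  imports "HOL-Complex_Analysis.Complex_Analysis"
    "HOL-Computational_Algebra.Computational_Algebra"
begin

(* Finite products are included: take alpha k = 0 for all but finitely many k. *)
definition LP' :: "(complex \<Rightarrow> complex) set" where
  "LP' = {\<phi>. \<phi> holomorphic_on UNIV \<and>
     (\<exists>(a::real) (c::real) (m::nat) (\<alpha>::nat \<Rightarrow> real).
        c \<noteq> 0 \<and> summable (\<lambda>k. (\<alpha> k)\<^sup>2) \<and>
        (\<forall>z. \<phi> z = of_real c * z ^ m * exp (- (of_real (a\<^sup>2) * z\<^sup>2)) *
               (\<Prod>k. (1 - of_real (\<alpha> k) * z) * exp (of_real (\<alpha> k) * z))))}"

(* The terms with k > degree P vanish, so the sum over all k is this finite one. *)
definition diff_op :: "(complex \<Rightarrow> complex) \<Rightarrow> real \<Rightarrow> complex poly \<Rightarrow> complex poly" where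
  "diff_op \<phi> s P =
     (\<Sum>k\<le>degree P. smult (fps_nth (fps_expansion \<phi> 0) k * of_real s ^ k) ((pderiv ^^ k) P))"

definition hyperbolic_polys :: "nat \<Rightarrow> complex poly set" where
  "hyperbolic_polys n = {P. lead_coeff P = 1 \<and> degree P = n \<and> (\<forall>z. poly P z = 0 \<longrightarrow> z \<in> \<real>)}"

(* Only meaningful when all zeros of P are real; Re then merely turns them into type real. *)
definition zeros :: "complex poly \<Rightarrow> real multiset" where
  "zeros P = image_mset Re (proots P)"

definition spectral_le :: "real multiset \<Rightarrow> real multiset \<Rightarrow> bool" where
  "spectral_le X Y \<longleftrightarrow> size X = size Y \<and>
     (\<forall>f::real \<Rightarrow> real. convex_on UNIV f \<longrightarrow>
        (\<Sum>x\<in>#X. f x) \<le> (\<Sum>y\<in>#Y. f y))"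

(* The order is a relation on hyperbolic_polys n, so it includes membership of both sides. *)
definition poly_spectral_le :: "nat \<Rightarrow> complex poly \<Rightarrow> complex poly \<Rightarrow> bool" where
  "poly_spectral_le n Q P \<longleftrightarrow>
     Q \<in> hyperbolic_polys n \<and> P \<in> hyperbolic_polys n \<and> spectral_le (zeros Q) (zeros P)"

end

theory Submission
  imports Defs
begin

text \<open>
  For a single factor (1 - \<alpha> z) exp (\<alpha> z) the operator sends a polynomial with simple zeros r to the
  characteristic polynomial of diag(r) + \<beta> (J - I), where \<beta> = \<alpha> s and all entries of J are 1. Decreasing
  |\<beta>| without changing its sign damps the off-diagonal part of this symmetric matrix, that is,
  averages the matrix with its diagonal, and therefore decreases its spectrum in the majorization order.
  Multiple zeros are reached by perturbation. As all operators commute, the factors of a product can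
  be changed from s to t one at a time, so monotonicity passes to finite products; since zeros depend
  continuously on coefficients, it passes to limits. This reaches the Gaussian factor, as the limit
  of (1 - a^2 z^2 / N)^N, and the infinite product.
\<close>

section \<open>Majorization of eigenvalues\<close>

definition orthonormal_rows :: "nat \<Rightarrow> (nat \<Rightarrow> nat \<Rightarrow> real) \<Rightarrow> bool" where
  "orthonormal_rows n p \<longleftrightarrow>
     (\<forall>i<n. \<forall>j<n. (\<Sum>k<n. p i k * p j k) = (if i = j then 1 else 0))"

lemma sum_bilinear_swap:
  fixes f :: "nat \<Rightarrow> nat \<Rightarrow> real"
  shows "(\<Sum>k<n. (\<Sum>i<n. f i k) * (\<Sum>j<n. g j k)) = (\<Sum>i<n. \<Sum>j<n. \<Sum>k<n. f i k * g j k)"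
proof -
  have "(\<Sum>k<n. (\<Sum>i<n. f i k) * (\<Sum>j<n. g j k)) = (\<Sum>k<n. \<Sum>i<n. \<Sum>j<n. f i k * g j k)"
    by (simp add: sum_product)
  also have "\<dots> = (\<Sum>i<n. \<Sum>k<n. \<Sum>j<n. f i k * g j k)"
    by (rule sum.swap)
  also have "\<dots> = (\<Sum>i<n. \<Sum>j<n. \<Sum>k<n. f i k * g j k)"
    by (intro sum.cong refl sum.swap)
  finally show ?thesis .
qed

text \<open>With C = p^T p, orthonormality of the rows gives trace C = n and makes C C^T agree with
  C on the diagonal. So row k of I - C has squared norm 1 - \<open>C k k\<close>; the total over all
  rows is n - n = 0, which forces C = I.\<close>

lemma orthonormal_columns:
  assumes "orthonormal_rows n p" "k < n" "l < n"
  shows "(\<Sum>i<n. p i k * p i l) = (if k = l then 1 else 0)"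
proof -
  have orth: "(\<Sum>k<n. p i k * p j k) = (if i = j then 1 else 0)" if "i < n" "j < n" for i j
    using assms(1) that by (auto simp: orthonormal_rows_def)
  define C where "C k l = (\<Sum>i<n. p i k * p i l)" for k l
  define d :: "nat \<Rightarrow> nat \<Rightarrow> real" where "d k l = (if k = l then 1 else 0)" for k l
  have tr: "(\<Sum>k<n. C k k) = n"
    unfolding C_def by (subst sum.swap) (simp add: orth)
  have "(\<Sum>l<n. C k l * C k l) = C k k" for k
  proof -
    have "(\<Sum>l<n. C k l * C k l) = (\<Sum>i<n. \<Sum>j<n. \<Sum>l<n. (p i k * p i l) * (p j k * p j l))"
      unfolding C_def by (rule sum_bilinear_swap)
    also have "\<dots> = (\<Sum>i<n. \<Sum>j<n. p i k * p j k * (\<Sum>l<n. p i l * p j l))"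
      by (simp add: sum_distrib_left mult_ac)
    also have "\<dots> = (\<Sum>i<n. \<Sum>j<n. if i = j then p i k * p j k else 0)"
      by (intro sum.cong refl) (auto simp: orth)
    also have "\<dots> = C k k"
      by (simp add: C_def)
    finally show ?thesis .
  qed
  moreover have "(\<Sum>l<n. (d k l - C k l)\<^sup>2) = 1 - 2 * C k k + (\<Sum>l<n. C k l * C k l)" if "k < n" for k
  proof -
    have "(d k l - C k l)\<^sup>2 = (if k = l then 1 - 2 * C k l else 0) + C k l * C k l" for l
      by (simp add: d_def power2_eq_square algebra_simps)
    then show ?thesis using that by (simp add: sum.distrib)
  qed
  ultimately have row: "(\<Sum>l<n. (d k l - C k l)\<^sup>2) = 1 - C k k" if "k < n" for k
    using that by simp
  have "(\<Sum>k<n. \<Sum>l<n. (d k l - C k l)\<^sup>2) = 0"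
    by (simp add: row sum_subtractf tr)
  then have "(d k l - C k l)\<^sup>2 = 0"
    using assms(2,3) by (simp add: sum_nonneg_eq_0_iff sum_nonneg)
  then show ?thesis by (simp add: d_def C_def)
qed

text \<open>Jensen's inequality in each row, whose entries are convex weights; summing over the
  rows, the column sums remove the weights again.\<close>

lemma convex_sum_le_doubly_stochastic:
  fixes f :: "real \<Rightarrow> real" and M :: "nat \<Rightarrow> nat \<Rightarrow> real"
  assumes f: "convex_on UNIV f"
    and nonneg: "\<And>i j. i < n \<Longrightarrow> j < n \<Longrightarrow> M i j \<ge> 0"
    and rows: "\<And>i. i < n \<Longrightarrow> (\<Sum>j<n. M i j) = 1"
    and cols: "\<And>j. j < n \<Longrightarrow> (\<Sum>i<n. M i j) = 1"
    and x: "\<And>i. i < n \<Longrightarrow> x i = (\<Sum>j<n. M i j * y j)"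
  shows "(\<Sum>i<n. f (x i)) \<le> (\<Sum>j<n. f (y j))"
proof -
  have "(\<Sum>i<n. f (x i)) \<le> (\<Sum>i<n. \<Sum>j<n. M i j * f (y j))"
  proof (intro sum_mono)
    fix i assume "i \<in> {..<n}"
    then have i: "i < n" by simp
    have "f (\<Sum>j<n. M i j *\<^sub>R y j) \<le> (\<Sum>j<n. M i j * f (y j))"
      using i rows nonneg by (intro convex_on_sum[OF _ _ f]) auto
    then show "f (x i) \<le> (\<Sum>j<n. M i j * f (y j))"
      using x[OF i] by simp
  qed
  also have "\<dots> = (\<Sum>j<n. \<Sum>i<n. M i j * f (y j))" by (rule sum.swap)
  also have "\<dots> = (\<Sum>j<n. f (y j))"
    by (intro sum.cong refl) (simp add: cols flip: sum_distrib_right)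
  finally show ?thesis .
qed

text \<open>
  The matrix B' damped off the diagonal is a mixture of unitary conjugates of B';
  the weights M below are the resulting doubly stochastic matrix in the two eigenbases.
\<close>
lemma convex_sum_eigenvalues_le:
  fixes f :: "real \<Rightarrow> real"
  assumes f: "convex_on UNIV f"
    and \<theta>: "0 \<le> \<theta>" "\<theta> \<le> 1"
    and p: "orthonormal_rows n p" and q: "orthonormal_rows n q"
    and B: "\<And>k l. k < n \<Longrightarrow> l < n \<Longrightarrow> B k l = (if k = l then B' k k else \<theta> * B' k l)"
    and eig: "\<And>i k. i < n \<Longrightarrow> k < n \<Longrightarrow> (\<Sum>l<n. B k l * p i l) = x i * p i k"
    and eig': "\<And>j k. j < n \<Longrightarrow> k < n \<Longrightarrow> (\<Sum>l<n. B' k l * q j l) = y j * q j k"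
  shows "(\<Sum>i<n. f (x i)) \<le> (\<Sum>j<n. f (y j))"
proof -
  \<comment> \<open>B is \<open>\<theta>\<close> B' plus 1 - \<open>\<theta>\<close> times the
    diagonal part of B'. Expanding the quadratic form of B at the eigenvector \<open>p i\<close> in
    the eigenbasis q, the first part gives \<open>y j\<close> the weight \<open>K i j\<close>, the
    squared inner product of \<open>p i\<close> and \<open>q j\<close>, and the diagonal part gives
    it the weight \<open>L i j\<close>.\<close>
  define K where "K i j = (\<Sum>k<n. p i k * q j k)\<^sup>2" for i j
  define L where "L i j = (\<Sum>k<n. (p i k)\<^sup>2 * (q j k)\<^sup>2)" for i j
  define M where "M i j = \<theta> * K i j + (1 - \<theta>) * L i j" for i j
  \<comment> \<open>The coefficients c stay free because they are used twice: c = 1 yields the row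
    sums, c = y the quadratic form of B'.\<close>
  have K_sum: "(\<Sum>j<n. c j * K i j) = (\<Sum>k<n. \<Sum>l<n. p i k * p i l * (\<Sum>j<n. c j * q j k * q j l))"
    for c i
  proof -
    have "(\<Sum>j<n. c j * K i j) = (\<Sum>j<n. (\<Sum>k<n. p i k * (c j * q j k)) * (\<Sum>l<n. p i l * q j l))"
      unfolding K_def power2_eq_square by (simp add: sum_distrib_left mult_ac)
    also have "\<dots> = (\<Sum>k<n. \<Sum>l<n. \<Sum>j<n. (p i k * (c j * q j k)) * (p i l * q j l))"
      by (rule sum_bilinear_swap)
    finally show ?thesis by (simp add: sum_distrib_left mult_ac)
  qed
  have L_sum: "(\<Sum>j<n. c j * L i j) = (\<Sum>k<n. (p i k)\<^sup>2 * (\<Sum>j<n. c j * q j k * q j k))" for c i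
    unfolding L_def sum_distrib_left by (subst sum.swap) (simp add: power2_eq_square mult_ac)
  \<comment> \<open>Spectral decomposition of B', from the eigenvector equations and the
    completeness of the basis q.\<close>
  have spec: "(\<Sum>j<n. y j * q j k * q j l) = B' k l" if kl: "k < n" "l < n" for k l
  proof -
    have "(\<Sum>j<n. y j * q j k * q j l) = (\<Sum>j<n. \<Sum>m<n. B' k m * q j m * q j l)"
      by (intro sum.cong refl) (simp add: eig'[OF _ kl(1), symmetric] sum_distrib_right)
    also have "\<dots> = (\<Sum>m<n. B' k m * (\<Sum>j<n. q j m * q j l))"
      by (subst sum.swap) (simp add: sum_distrib_left mult_ac)
    also have "\<dots> = (\<Sum>m<n. if m = l then B' k m else 0)"
      using kl by (intro sum.cong refl) (auto simp: orthonormal_columns[OF q])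
    finally show ?thesis using kl by simp
  qed
  have p1: "(\<Sum>k<n. (p i k)\<^sup>2) = 1" if "i < n" for i
    using p that by (simp add: orthonormal_rows_def power2_eq_square)
  have q1: "(\<Sum>k<n. (q i k)\<^sup>2) = 1" if "i < n" for i
    using q that by (simp add: orthonormal_rows_def power2_eq_square)
  show ?thesis
  proof (rule convex_sum_le_doubly_stochastic[OF f, where M = M])
    fix i j assume "i < n" "j < n"
    show "M i j \<ge> 0"
      unfolding M_def K_def L_def using \<theta> by (intro add_nonneg_nonneg mult_nonneg_nonneg sum_nonneg) auto
  next
    fix i assume i: "i < n"
    have "(\<Sum>j<n. K i j) = (\<Sum>k<n. \<Sum>l<n. p i k * p i l * (\<Sum>j<n. q j k * q j l))"
      using K_sum[of "\<lambda>_. 1" i] by simp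
    also have "\<dots> = (\<Sum>k<n. \<Sum>l<n. if k = l then p i k * p i l else 0)"
      by (intro sum.cong refl) (auto simp: orthonormal_columns[OF q])
    also have "\<dots> = 1" using p1[OF i] by (simp add: power2_eq_square)
    finally have "(\<Sum>j<n. K i j) = 1" .
    moreover have "(\<Sum>j<n. L i j) = 1"
      using L_sum[of "\<lambda>_. 1" i] p1[OF i] by (simp add: orthonormal_columns[OF q])
    ultimately show "(\<Sum>j<n. M i j) = 1"
      by (simp add: M_def sum.distrib flip: sum_distrib_left)
  next
    fix j assume j: "j < n"
    have "(\<Sum>i<n. K i j) = (\<Sum>k<n. \<Sum>l<n. \<Sum>i<n. (p i k * q j k) * (p i l * q j l))"
      unfolding K_def power2_eq_square
      using sum_bilinear_swap[of "\<lambda>k i. p i k * q j k" n "\<lambda>k i. p i k * q j k"] by simp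
    also have "\<dots> = (\<Sum>k<n. \<Sum>l<n. q j k * q j l * (\<Sum>i<n. p i k * p i l))"
      by (simp add: sum_distrib_left mult_ac)
    also have "\<dots> = (\<Sum>k<n. \<Sum>l<n. if k = l then q j k * q j l else 0)"
      by (intro sum.cong refl) (auto simp: orthonormal_columns[OF p])
    also have "\<dots> = 1" using q1[OF j] by (simp add: power2_eq_square)
    finally have "(\<Sum>i<n. K i j) = 1" .
    moreover have "(\<Sum>i<n. L i j) = (\<Sum>k<n. (q j k)\<^sup>2 * (\<Sum>i<n. p i k * p i k))"
      unfolding L_def by (subst sum.swap) (simp add: power2_eq_square sum_distrib_left mult_ac)
    then have "(\<Sum>i<n. L i j) = 1"
      using q1[OF j] by (simp add: orthonormal_columns[OF p])
    ultimately show "(\<Sum>i<n. M i j) = 1"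
      by (simp add: M_def sum.distrib flip: sum_distrib_left)
  next
    fix i assume i: "i < n"
    have "(\<Sum>j<n. M i j * y j) = \<theta> * (\<Sum>j<n. y j * K i j) + (1 - \<theta>) * (\<Sum>j<n. y j * L i j)"
      by (simp add: M_def sum.distrib algebra_simps sum_distrib_left sum_subtractf)
    also have "\<dots> = \<theta> * (\<Sum>k<n. \<Sum>l<n. p i k * p i l * B' k l) + (1 - \<theta>) * (\<Sum>k<n. (p i k)\<^sup>2 * B' k k)"
      unfolding K_sum L_sum by (simp add: spec)
    also have "(\<Sum>k<n. (p i k)\<^sup>2 * B' k k) = (\<Sum>k<n. \<Sum>l<n. if k = l then p i k * p i l * B' k l else 0)"
      by (simp add: power2_eq_square)
    also have "\<theta> * (\<Sum>k<n. \<Sum>l<n. p i k * p i l * B' k l) + (1 - \<theta>) * \<dots> =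
               (\<Sum>k<n. \<Sum>l<n. p i k * p i l * B k l)"
      unfolding sum_distrib_left sum.distrib[symmetric]
      by (intro sum.cong refl) (auto simp: B algebra_simps)
    also have "\<dots> = (\<Sum>k<n. p i k * (\<Sum>l<n. B k l * p i l))"
      by (simp add: sum_distrib_left mult_ac)
    also have "\<dots> = x i * (\<Sum>k<n. (p i k)\<^sup>2)"
      using i by (simp add: eig sum_distrib_left power2_eq_square mult_ac)
    finally show "x i = (\<Sum>j<n. M i j * y j)" using p1[OF i] by simp
  qed
qed

section \<open>Polynomials with real zeros\<close>

text \<open>Indexing the zeros lets them be sorted, perturbed and passed to limits individually; the
  multiset \<open>zeros\<close> is recovered by forgetting the index.\<close>

definition real_rooted :: "nat \<Rightarrow> (nat \<Rightarrow> real) \<Rightarrow> complex poly" where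
  "real_rooted n r = (\<Prod>k<n. [:- of_real (r k), 1:])"

lemma degree_real_rooted [simp]: "degree (real_rooted n r) = n"
  by (simp add: real_rooted_def degree_prod_sum_eq)

lemma monic_real_rooted [simp]: "lead_coeff (real_rooted n r) = 1"
  by (simp add: real_rooted_def lead_coeff_prod)

lemma coeff_real_rooted_degree [simp]: "coeff (real_rooted n r) n = 1"
  using monic_real_rooted[of n r] by simp

lemma real_rooted_nonzero [simp]: "real_rooted n r \<noteq> 0"
  by (simp add: real_rooted_def)

lemma poly_real_rooted: "poly (real_rooted n r) z = (\<Prod>k<n. z - of_real (r k))"
  by (simp add: real_rooted_def poly_prod)

lemma zeros_real_rooted: "zeros (real_rooted n r) = image_mset r (mset_set {..<n})"
proof (induction n)
  case (Suc n)
  have "real_rooted (Suc n) r = real_rooted n r * [:- of_real (r n), 1:]"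
    by (simp add: real_rooted_def)
  then show ?case
    using Suc by (simp add: zeros_def proots_mult lessThan_Suc del: mult_pCons_right)
qed (simp add: zeros_def real_rooted_def)

lemma real_rooted_in_hyperbolic [intro]: "real_rooted n r \<in> hyperbolic_polys n"
  using monic_real_rooted[of n r] by (auto simp: hyperbolic_polys_def poly_real_rooted)

lemma hyperbolic_real_rooted:
  assumes "P \<in> hyperbolic_polys n"
  obtains r where "P = real_rooted n r"
proof -
  have P: "coeff P n = 1" "degree P = n" "\<And>z. poly P z = 0 \<Longrightarrow> z \<in> \<real>"
    using assms by (auto simp: hyperbolic_polys_def)
  obtain root where root: "smult (lead_coeff P) (\<Prod>i<degree P. [:-root i, 1:]) = P"
    using complex_poly_decompose' .
  have "root i \<in> \<real>" if "i < n" for i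
  proof (rule P(3))
    have "poly P (root i) = (\<Prod>j<n. root i - root j)"
      by (subst root[symmetric]) (simp only: P, simp add: P poly_prod)
    then show "poly P (root i) = 0" using that by auto
  qed
  then have "P = real_rooted n (\<lambda>i. Re (root i))"
    using root unfolding real_rooted_def by (simp add: P)
  then show ?thesis ..
qed

text \<open>Sorted zeros are the starting point for separating multiple zeros in
  \<open>spectral_monotone_genus_one\<close>.\<close>

lemma hyperbolic_sorted_roots:
  assumes "P \<in> hyperbolic_polys n"
  obtains r where "P = real_rooted n r" "\<forall>i j. i \<le> j \<longrightarrow> j < n \<longrightarrow> r i \<le> r j"
proof -
  obtain r where r: "P = real_rooted n r" using hyperbolic_real_rooted[OF assms] .
  define l where "l = sort (map r [0..<n])"
  have l: "length l = n" "sorted l" by (simp_all add: l_def)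
  have "P = (\<Prod>x\<in>#mset (map r [0..<n]). [:- of_real x, 1:])"
    unfolding r real_rooted_def
    by (simp add: prod_unfold_prod_mset image_mset.compositionality o_def flip: atLeast0LessThan)
  also have "\<dots> = (\<Prod>x\<in>#mset l. [:- of_real x, 1:])" by (simp add: l_def)
  also have "\<dots> = (\<Prod>x\<leftarrow>l. [:- of_real x, 1:])"
    by (simp flip: prod_mset_prod_list)
  also have "\<dots> = real_rooted n (\<lambda>i. l ! i)"
    by (subst prod.list_conv_set_nth) (simp add: real_rooted_def atLeast0LessThan l)
  finally show ?thesis
    by (rule that) (use l in \<open>auto intro: sorted_nth_mono\<close>)
qed

lemma poly_spectral_le_real_rooted_iff:
  "poly_spectral_le n (real_rooted n x) (real_rooted n y) \<longleftrightarrow>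
     (\<forall>f. convex_on UNIV f \<longrightarrow> (\<Sum>i<n. f (x i)) \<le> (\<Sum>i<n. f (y i)))"
  by (auto simp: poly_spectral_le_def spectral_le_def zeros_real_rooted image_mset.compositionality
        o_def sum_unfold_sum_mset[symmetric])

lemma poly_spectral_le_refl: "P \<in> hyperbolic_polys n \<Longrightarrow> poly_spectral_le n P P"
  by (simp add: poly_spectral_le_def spectral_le_def)

lemma poly_spectral_le_trans:
  "poly_spectral_le n P Q \<Longrightarrow> poly_spectral_le n Q R \<Longrightarrow> poly_spectral_le n P R"
  by (fastforce simp: poly_spectral_le_def spectral_le_def intro: order_trans)

section \<open>Bounds and limits of zeros, and closedness of the spectral order\<close>

lemma finite_seq_compact:
  fixes x :: "nat \<Rightarrow> nat \<Rightarrow> real"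
  assumes "\<And>N i. i < n \<Longrightarrow> \<bar>x N i\<bar> \<le> B"
  obtains r l where "strict_mono r" "\<forall>i<n. (\<lambda>N. x (r N) i) \<longlonglongrightarrow> l i"
  using assms
proof (induction n arbitrary: thesis)
  case 0
  then show ?case using strict_mono_id by blast
next
  case (Suc n)
  from Suc.prems(2) have "\<And>N i. i < n \<Longrightarrow> \<bar>x N i\<bar> \<le> B" by simp
  from Suc.IH[OF _ this] obtain r l
    where r: "strict_mono r" "\<forall>i<n. (\<lambda>N. x (r N) i) \<longlonglongrightarrow> l i" .
  have "compact {-B..B}" by simp
  moreover have "\<forall>N. x (r N) n \<in> {-B..B}" using Suc.prems(2) by (auto simp: abs_le_iff minus_le_iff)
  ultimately obtain m q where q: "strict_mono q" "((\<lambda>N. x (r N) n) \<circ> q) \<longlonglongrightarrow> m"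
    unfolding compact_def by meson
  show ?case
  proof (rule Suc.prems(1))
    show "strict_mono (r \<circ> q)" using r(1) q(1) by (rule strict_mono_o)
    have "(\<lambda>N. x ((r \<circ> q) N) i) \<longlonglongrightarrow> (l(n := m)) i" if "i < Suc n" for i
    proof (cases "i = n")
      case True
      then show ?thesis using q(2) by (simp add: o_def)
    next
      case False
      then have "((\<lambda>N. x (r N) i) \<circ> q) \<longlonglongrightarrow> l i"
        using r(2) that q(1) by (intro LIMSEQ_subseq_LIMSEQ) auto
      then show ?thesis using False by (simp add: o_def)
    qed
    then show "\<forall>i<Suc n. (\<lambda>N. x ((r \<circ> q) N) i) \<longlonglongrightarrow> (l(n := m)) i" by blast
  qed
qed

text \<open>A Cauchy-type bound: for |z| > 1 isolate the leading term, bound every lower power of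
  |z| by |z|^(n-1), and cancel that power.\<close>

lemma root_le_sum_coeffs:
  fixes P :: "complex poly"
  assumes "lead_coeff P = 1" "poly P z = 0"
  shows "norm z \<le> 1 + (\<Sum>k<degree P. norm (coeff P k))"
proof (cases "norm z \<le> 1")
  case True
  then show ?thesis by (simp add: add_increasing2 sum_nonneg)
next
  case False
  let ?n = "degree P"
  have "?n \<noteq> 0"
  proof
    assume "?n = 0"
    then obtain a where "P = [:a:]" by (rule degree_eq_zeroE)
    then show False using assms by simp
  qed
  then obtain m where m: "?n = Suc m" using not0_implies_Suc by blast
  have "0 = (\<Sum>k<?n. coeff P k * z ^ k) + z ^ ?n"
    using assms by (simp add: poly_altdef flip: lessThan_Suc_atMost)
  then have "z ^ ?n = - (\<Sum>k<?n. coeff P k * z ^ k)" by (simp add: eq_neg_iff_add_eq_0 add.commute)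
  then have "norm z ^ ?n = norm (\<Sum>k<?n. coeff P k * z ^ k)" by (metis norm_minus_cancel norm_power)
  also have "\<dots> \<le> (\<Sum>k<?n. norm (coeff P k) * norm z ^ m)"
    using False m
    by (intro sum_norm_le) (auto simp: norm_mult norm_power intro!: mult_left_mono power_increasing)
  also have "\<dots> = (\<Sum>k<?n. norm (coeff P k)) * norm z ^ m" by (simp add: sum_distrib_right)
  finally have "norm z * norm z ^ m \<le> (\<Sum>k<?n. norm (coeff P k)) * norm z ^ m"
    by (simp add: m)
  moreover have "norm z ^ m > 0" using False by (intro zero_less_power) linarith
  ultimately have "norm z \<le> (\<Sum>k<?n. norm (coeff P k))"
    by (metis mult_le_cancel_right_pos)
  then show ?thesis by simp
qed

lemma real_rooted_roots_bounded:
  assumes "\<And>k. (\<lambda>N. coeff (real_rooted n (x N)) k) \<longlonglongrightarrow> coeff P k"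
  obtains B where "\<forall>N. \<forall>i<n. \<bar>x N i\<bar> \<le> B"
proof -
  let ?S = "\<lambda>N. 1 + (\<Sum>k<n. norm (coeff (real_rooted n (x N)) k))"
  have "?S \<longlonglongrightarrow> 1 + (\<Sum>k<n. norm (coeff P k))"
    by (intro tendsto_intros assms)
  then have "Bseq ?S" by (intro convergent_imp_Bseq convergentI)
  then obtain B where B: "\<And>N. norm (?S N) \<le> B" by (auto simp: Bseq_def)
  have "\<bar>x N i\<bar> \<le> B" if "i < n" for N i
  proof -
    have "poly (real_rooted n (x N)) (of_real (x N i)) = 0"
      using that by (auto simp: poly_real_rooted)
    from root_le_sum_coeffs[OF monic_real_rooted this] have "\<bar>x N i\<bar> \<le> ?S N" by simp
    also have "\<dots> \<le> B" using B[of N] by simp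
    finally show ?thesis .
  qed
  then show ?thesis using that by blast
qed

text \<open>At each point z the values of the polynomials converge both to that of P, through the
  coefficients, and to that of the product over l, through the zeros.\<close>

lemma real_rooted_limit:
  assumes P: "\<And>k. (\<lambda>N. coeff (real_rooted n (x N)) k) \<longlonglongrightarrow> coeff P k"
    and x: "\<And>i. i < n \<Longrightarrow> (\<lambda>N. x N i) \<longlonglongrightarrow> l i"
  shows "P = real_rooted n l"
proof -
  have "coeff P k = 0" if "k > n" for k
  proof (rule LIMSEQ_unique[OF P])
    show "(\<lambda>N. coeff (real_rooted n (x N)) k) \<longlonglongrightarrow> 0"
      using that by (simp add: coeff_eq_0)
  qed
  then have deg: "degree P \<le> n" by (intro degree_le) auto
  have "poly P z = poly (real_rooted n l) z" for z
  proof (rule LIMSEQ_unique)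
    have eval: "poly p z = (\<Sum>k\<le>n. coeff p k * z ^ k)" if "degree p \<le> n" for p :: "complex poly"
      unfolding poly_altdef using that
      by (intro sum.mono_neutral_left) (auto simp: coeff_eq_0)
    show "(\<lambda>N. poly (real_rooted n (x N)) z) \<longlonglongrightarrow> poly P z"
      unfolding eval[OF deg] eval[OF eq_refl[OF degree_real_rooted]]
      by (intro tendsto_intros P)
    show "(\<lambda>N. poly (real_rooted n (x N)) z) \<longlonglongrightarrow> poly (real_rooted n l) z"
      unfolding poly_real_rooted by (intro tendsto_intros x) auto
  qed
  then have "poly P = poly (real_rooted n l)" by (rule ext)
  then show ?thesis by (simp only: poly_eq_poly_eq_iff)
qed

text \<open>Convergent coefficients keep the zeros bounded, so along a common subsequence both
  tuples of zeros converge, necessarily to the zeros of the limits. A convex function on the whole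
  line is continuous, so its inequality survives.\<close>

lemma poly_spectral_le_limit:
  assumes le: "\<And>N. poly_spectral_le n (Q N) (P N)"
    and Q: "\<And>k. (\<lambda>N. coeff (Q N) k) \<longlonglongrightarrow> coeff Q' k"
    and P: "\<And>k. (\<lambda>N. coeff (P N) k) \<longlonglongrightarrow> coeff P' k"
  shows "poly_spectral_le n Q' P'"
proof -
  have "\<exists>x. Q N = real_rooted n x" "\<exists>y. P N = real_rooted n y" for N
    using le[of N] by (auto simp: poly_spectral_le_def elim: hyperbolic_real_rooted)
  then obtain x y where x: "\<And>N. Q N = real_rooted n (x N)" and y: "\<And>N. P N = real_rooted n (y N)"
    by metis
  obtain B where B: "\<forall>N. \<forall>i<n. \<bar>x N i\<bar> \<le> B"
    using real_rooted_roots_bounded[OF Q[unfolded x]] .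
  obtain r a where r: "strict_mono r" "\<forall>i<n. (\<lambda>N. x (r N) i) \<longlonglongrightarrow> a i"
    by (rule finite_seq_compact[of n x B]) (use B in auto)
  obtain C where C: "\<forall>N. \<forall>i<n. \<bar>y N i\<bar> \<le> C"
    using real_rooted_roots_bounded[OF P[unfolded y]] .
  obtain q b where q: "strict_mono q" "\<forall>i<n. (\<lambda>N. y (r (q N)) i) \<longlonglongrightarrow> b i"
    by (rule finite_seq_compact[of n "\<lambda>N. y (r N)" C]) (use C in auto)
  define s where "s = r \<circ> q"
  have s: "strict_mono s" unfolding s_def by (rule strict_mono_o[OF r(1) q(1)])
  have xs: "(\<lambda>N. x (s N) i) \<longlonglongrightarrow> a i" if "i < n" for i
    using LIMSEQ_subseq_LIMSEQ[OF r(2)[rule_format, OF that] q(1)] by (simp add: s_def o_def)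
  have ys: "(\<lambda>N. y (s N) i) \<longlonglongrightarrow> b i" if "i < n" for i
    using q(2) that by (simp add: s_def)
  have Q': "Q' = real_rooted n a"
    by (rule real_rooted_limit[OF _ xs])
       (use LIMSEQ_subseq_LIMSEQ[OF Q s] in \<open>simp_all add: x o_def\<close>)
  have P': "P' = real_rooted n b"
    by (rule real_rooted_limit[OF _ ys])
       (use LIMSEQ_subseq_LIMSEQ[OF P s] in \<open>simp_all add: y o_def\<close>)
  show ?thesis
    unfolding Q' P' poly_spectral_le_real_rooted_iff
  proof (intro allI impI)
    fix f :: "real \<Rightarrow> real" assume f: "convex_on UNIV f"
    have cont: "isCont f u" for u
      using convex_on_continuous[OF open_UNIV f] by (simp add: continuous_on_eq_continuous_at)
    show "(\<Sum>i<n. f (a i)) \<le> (\<Sum>i<n. f (b i))"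
    proof (rule LIMSEQ_le)
      show "(\<lambda>N. \<Sum>i<n. f (x (s N) i)) \<longlonglongrightarrow> (\<Sum>i<n. f (a i))"
        by (intro tendsto_sum isCont_tendsto_compose[OF cont] xs) auto
      show "(\<lambda>N. \<Sum>i<n. f (y (s N) i)) \<longlonglongrightarrow> (\<Sum>i<n. f (b i))"
        by (intro tendsto_sum isCont_tendsto_compose[OF cont] ys) auto
      show "\<exists>N. \<forall>m\<ge>N. (\<Sum>i<n. f (x (s m) i)) \<le> (\<Sum>i<n. f (y (s m) i))"
        using le f unfolding x y poly_spectral_le_real_rooted_iff by blast
    qed
  qed
qed

section \<open>The operator of a single genus-one factor\<close>

lemma poly_pderiv_real_rooted:
  "poly (pderiv (real_rooted n r)) z = (\<Sum>k<n. \<Prod>j\<in>{..<n} - {k}. z - of_real (r j))"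
  by (simp add: real_rooted_def pderiv_prod poly_sum poly_prod pderiv_pCons)

lemma log_deriv_real_rooted:
  assumes "poly (real_rooted n r) z \<noteq> 0"
  shows "poly (pderiv (real_rooted n r)) z =
         poly (real_rooted n r) z * (\<Sum>k<n. 1 / (z - of_real (r k)))"
  unfolding poly_pderiv_real_rooted sum_distrib_left
proof (intro sum.cong refl)
  fix k assume k: "k \<in> {..<n}"
  have "poly (real_rooted n r) z = (z - of_real (r k)) * (\<Prod>j\<in>{..<n} - {k}. z - of_real (r j))"
    unfolding poly_real_rooted using k by (subst prod.remove) auto
  moreover have "z - of_real (r k) \<noteq> 0" using assms k by (auto simp: poly_real_rooted)
  ultimately show "(\<Prod>j\<in>{..<n} - {k}. z - of_real (r j)) =
      poly (real_rooted n r) z * (1 / (z - of_real (r k)))" by simp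
qed

text \<open>Away from the zeros of R the equation says beta R'/R = 1. The imaginary part of each
  term 1 / (z - r k) of R'/R is -Im z / |z - r k|^2; these all have the same sign, so they can only
  cancel if Im z = 0.\<close>

lemma hyperbolic_diff_pderiv:
  "real_rooted n r - smult (of_real \<beta>) (pderiv (real_rooted n r)) \<in> hyperbolic_polys n"
proof -
  define R where "R = real_rooted n r"
  let ?P = "R - smult (of_real \<beta>) (pderiv R)"
  have cn: "coeff ?P n = 1"
    by (simp add: R_def coeff_pderiv coeff_eq_0)
  moreover have "degree ?P \<le> n"
    by (intro degree_le) (simp add: R_def coeff_pderiv coeff_eq_0)
  ultimately have deg: "degree ?P = n" using le_degree[of ?P n] by simp
  have "z \<in> \<real>" if z: "poly ?P z = 0" for z
  proof (cases "poly R z = 0")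
    case True
    then show ?thesis by (auto simp: R_def poly_real_rooted)
  next
    case False
    have "poly R z * (1 - of_real \<beta> * (\<Sum>k<n. 1 / (z - of_real (r k)))) = 0"
      using z log_deriv_real_rooted[of n r z] False by (simp add: R_def algebra_simps)
    then have one: "of_real \<beta> * (\<Sum>k<n. 1 / (z - of_real (r k))) = 1" using False by simp
    have "Im (of_real \<beta> * (\<Sum>k<n. 1 / (z - of_real (r k)))) =
          - \<beta> * Im z * (\<Sum>k<n. 1 / (norm (z - of_real (r k)))\<^sup>2)"
      by (simp add: Im_divide cmod_power2 sum_negf sum_distrib_left sum_divide_distrib)
    then have "\<beta> * Im z * (\<Sum>k<n. 1 / (norm (z - of_real (r k)))\<^sup>2) = 0" using one by simp
    moreover have "\<beta> \<noteq> 0" using one by auto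
    moreover have "(\<Sum>k<n. 1 / (norm (z - of_real (r k)))\<^sup>2) > 0"
    proof (rule sum_pos)
      show "{..<n} \<noteq> {}" using one by auto
      show "1 / (norm (z - of_real (r k)))\<^sup>2 > 0" if "k \<in> {..<n}" for k
        using that False by (auto simp: R_def poly_real_rooted)
    qed simp
    ultimately have "Im z = 0" by simp
    then show ?thesis by (simp add: complex_is_Real_iff)
  qed
  then show ?thesis using cn deg by (simp add: hyperbolic_polys_def flip: R_def)
qed

text \<open>Whichever factor the product rule drops, one of the two factors vanishing at the
  repeated zero remains.\<close>

lemma pderiv_real_rooted_double:
  assumes "i < n" "j < n" "i \<noteq> j" "x i = x j"
  shows "poly (pderiv (real_rooted n x)) (of_real (x i)) = 0"
  unfolding poly_pderiv_real_rooted
proof (intro sum.neutral ballI)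
  fix k assume "k \<in> {..<n}"
  obtain l where "l \<in> {..<n} - {k}" "x l = x i" using assms by (metis Diff_iff lessThan_iff singletonD)
  then show "(\<Prod>l\<in>{..<n} - {k}. complex_of_real (x i) - of_real (x l)) = 0"
    by (intro prod_zero bexI[of _ l]) auto
qed

text \<open>
  The polynomial R - beta R' is the characteristic polynomial of the rank-one perturbation
  diag(r) + beta J, where all entries of J are 1; the vectors with entries 1 / (x i - r k)
  are its eigenvectors.
\<close>
lemma diff_pderiv_eigenbasis:
  assumes r: "inj_on r {..<n}"
  obtains x p where
    "real_rooted n r - smult (of_real \<beta>) (pderiv (real_rooted n r)) = real_rooted n x"
    "orthonormal_rows n p"
    "\<And>i k. i < n \<Longrightarrow> k < n \<Longrightarrow> r k * p i k + \<beta> * (\<Sum>l<n. p i l) = x i * p i k"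
proof (cases "\<beta> = 0")
  case True
  \<comment> \<open>Here the matrix is diag(r) itself, with x = r, and the vectors with entries 1 /
    (x i - r k) would break down; the standard basis takes their place.\<close>
  let ?p = "\<lambda>i k. if i = k then 1 else 0 :: real"
  show ?thesis
  proof (rule that[of r ?p])
    have "(\<Sum>k<n. ?p i k * ?p j k) = (if i = j then 1 else 0)" if "i < n" "j < n" for i j
    proof -
      have "(\<Sum>k<n. ?p i k * ?p j k) = (\<Sum>k<n. if i = k then ?p j i else 0)"
        by (intro sum.cong) auto
      then show ?thesis using that by simp
    qed
    then show "orthonormal_rows n ?p" by (simp add: orthonormal_rows_def)
  qed (use True in auto)
next
  case \<beta>: False
  define R where "R = real_rooted n r"
  define P where "P = R - smult (of_real \<beta>) (pderiv R)"
  obtain x where x: "P = real_rooted n x"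
    using hyperbolic_real_rooted[OF hyperbolic_diff_pderiv] unfolding P_def R_def by metis
  have Px: "poly P (of_real (x i)) = 0" if "i < n" for i
    using that by (auto simp: x poly_real_rooted)
  \<comment> \<open>A common zero of P and R would be a zero of R', but the zeros of R are simple.
    This keeps all denominators x i - r k away from 0.\<close>
  have Rx: "poly R (of_real (x i)) \<noteq> 0" if i: "i < n" for i
  proof
    assume R0: "poly R (of_real (x i)) = 0"
    then obtain k where k: "k < n" "x i = r k" by (auto simp: R_def poly_real_rooted)
    have "poly (pderiv R) (of_real (x i)) = 0"
      using Px[OF i] R0 \<beta> by (simp add: P_def)
    moreover have "poly (pderiv R) (of_real (x i)) =
        (\<Prod>j\<in>{..<n} - {k}. complex_of_real (r k) - of_real (r j)) +
        (\<Sum>l\<in>{..<n} - {k}. \<Prod>j\<in>{..<n} - {l}. complex_of_real (r k) - of_real (r j))"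
      unfolding R_def poly_pderiv_real_rooted k(2) using k(1) by (subst sum.remove[of _ k]) auto
    moreover have "(\<Sum>l\<in>{..<n} - {k}. \<Prod>j\<in>{..<n} - {l}. complex_of_real (r k) - of_real (r j)) = 0"
      using k(1) by (intro sum.neutral ballI prod_zero) auto
    moreover have "(\<Prod>j\<in>{..<n} - {k}. complex_of_real (r k) - of_real (r j)) \<noteq> 0"
      using r k(1) by (auto simp: inj_on_def)
    ultimately show False by simp
  qed
  have xr: "x i \<noteq> r k" if "i < n" "k < n" for i k
    using Rx[OF that(1)] that(2) by (auto simp: R_def poly_real_rooted)
  have P_eq: "poly P z = poly R z * (1 - of_real \<beta> * (\<Sum>k<n. 1 / (z - of_real (r k))))"
    if "poly R z \<noteq> 0" for z
    using log_deriv_real_rooted[of n r z] that by (simp add: P_def R_def algebra_simps)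
  \<comment> \<open>The secular equation of the rank-one perturbation. It evaluates the coordinate
    sum of an eigenvector and later makes different eigenvectors orthogonal.\<close>
  have secular: "(\<Sum>k<n. 1 / (x i - r k)) = 1 / \<beta>" if i: "i < n" for i
  proof -
    have "complex_of_real (1 - \<beta> * (\<Sum>k<n. 1 / (x i - r k))) = 0"
      using P_eq[OF Rx[OF i]] Px[OF i] Rx[OF i] by simp
    then have "1 - \<beta> * (\<Sum>k<n. 1 / (x i - r k)) = 0" by (simp only: of_real_eq_0_iff)
    then show ?thesis using \<beta> by (simp add: field_simps)
  qed
  have S: "(\<Sum>k<n. 1 / (x i - r k)\<^sup>2) > 0" if i: "i < n" for i
    using i xr[OF i] by (intro sum_pos) auto
  \<comment> \<open>At a repeated zero the derivative of P / R would vanish. But P / R is 1 - beta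
    times the sum of 1 / (z - r k), whose derivative at the real point x i is beta times a positive
    sum of squares.\<close>
  have inj: "x i \<noteq> x j" if ij: "i < n" "j < n" "i \<noteq> j" for i j
  proof
    assume eq: "x i = x j"
    let ?z = "complex_of_real (x i)"
    have "((\<lambda>z. poly P z / poly R z) has_field_derivative
        (poly (pderiv P) ?z * poly R ?z - poly P ?z * poly (pderiv R) ?z) / (poly R ?z * poly R ?z)) (at ?z)"
      by (intro DERIV_divide poly_DERIV Rx ij)
    then have d1: "((\<lambda>z. poly P z / poly R z) has_field_derivative 0) (at ?z)"
      using Px[OF ij(1)] pderiv_real_rooted_double[OF ij eq] by (simp add: x)
    have "((\<lambda>z. 1 - of_real \<beta> * (\<Sum>k<n. 1 / (z - of_real (r k)))) has_field_derivative
        of_real \<beta> * (\<Sum>k<n. 1 / (?z - of_real (r k))\<^sup>2)) (at ?z)"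
      using xr[OF ij(1)]
      by (auto intro!: derivative_eq_intros simp: power2_eq_square sum_negf)
    moreover have "open {z. poly R z \<noteq> 0}"
      by (intro open_Collect_neq continuous_intros)
    ultimately have "((\<lambda>z. poly P z / poly R z) has_field_derivative
        of_real \<beta> * (\<Sum>k<n. 1 / (?z - of_real (r k))\<^sup>2)) (at ?z)"
      by (rule has_field_derivative_transform_within_open) (auto simp: P_eq Rx ij)
    then have "of_real \<beta> * (\<Sum>k<n. 1 / (?z - of_real (r k))\<^sup>2) = 0"
      using DERIV_unique d1 by metis
    then have "complex_of_real (\<Sum>k<n. 1 / (x i - r k)\<^sup>2) = 0" using \<beta> by simp
    then show False using S[OF ij(1)] by (simp only: of_real_eq_0_iff)
  qed
  define N where "N i = sqrt (\<Sum>k<n. 1 / (x i - r k)\<^sup>2)" for i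
  define p where "p i k = 1 / (x i - r k) / N i" for i k
  have N: "N i > 0" "(N i)\<^sup>2 = (\<Sum>k<n. 1 / (x i - r k)\<^sup>2)" if "i < n" for i
    using S[OF that] by (auto simp: N_def)
  show ?thesis
  proof (rule that[of x p])
    show "real_rooted n r - smult (of_real \<beta>) (pderiv (real_rooted n r)) = real_rooted n x"
      using x by (simp add: P_def R_def)
    have "(\<Sum>k<n. p i k * p j k) = (if i = j then 1 else 0)" if ij: "i < n" "j < n" for i j
    proof (cases "i = j")
      case True
      have "(\<Sum>k<n. p i k * p i k) = (\<Sum>k<n. 1 / (x i - r k)\<^sup>2) / (N i)\<^sup>2"
        by (simp add: p_def sum_divide_distrib power2_eq_square mult_ac)
      then show ?thesis using N(2)[OF ij(1)] S[OF ij(1)] True by simp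
    next
      case False
      \<comment> \<open>Partial fractions: the sum over k becomes a difference of two secular sums,
        both equal to 1 / \<open>\<beta>\<close>.\<close>
      have "p i k * p j k = (1 / (x i - r k) - 1 / (x j - r k)) / ((x j - x i) * N i * N j)"
        if "k < n" for k
      proof -
        have "1 / (x i - r k) * (1 / (x j - r k)) = (1 / (x i - r k) - 1 / (x j - r k)) / (x j - x i)"
          using inj[OF ij False] xr[OF ij(1) that] xr[OF ij(2) that] by (simp add: diff_frac_eq)
        moreover have "p i k * p j k = 1 / (x i - r k) * (1 / (x j - r k)) / (N i * N j)"
          by (simp add: p_def)
        ultimately show ?thesis by (simp only:) (simp add: mult_ac)
      qed
      then have "(\<Sum>k<n. p i k * p j k) =
          ((\<Sum>k<n. 1 / (x i - r k)) - (\<Sum>k<n. 1 / (x j - r k))) / ((x j - x i) * N i * N j)"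
        by (simp add: sum_subtractf flip: sum_divide_distrib)
      then show ?thesis using False ij by (simp add: secular)
    qed
    then show "orthonormal_rows n p" by (simp add: orthonormal_rows_def)
    fix i k assume ik: "i < n" "k < n"
    have sum_p: "(\<Sum>l<n. p i l) = 1 / \<beta> / N i"
      unfolding p_def sum_divide_distrib[symmetric] secular[OF ik(1)] ..
    show "r k * p i k + \<beta> * (\<Sum>l<n. p i l) = x i * p i k"
      unfolding sum_p using \<beta> N(1)[OF ik(1)] xr[OF ik] by (simp add: p_def field_simps)
  qed
qed

lemma pcompose_shift_real_rooted:
  "pcompose (real_rooted n x) [:of_real \<beta>, 1:] = real_rooted n (\<lambda>i. x i - \<beta>)"
  by (simp add: real_rooted_def pcompose_prod pcompose_pCons)

text \<open>This is exp(beta D)(1 - beta D). The translation subtracts beta from every zero, turning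
  diag(r) + beta J into diag(r) + beta (J - I), whose diagonal no longer depends on beta.\<close>

definition shifted_step :: "real \<Rightarrow> complex poly \<Rightarrow> complex poly" where
  "shifted_step \<beta> R = pcompose (R - smult (of_real \<beta>) (pderiv R)) [:of_real \<beta>, 1:]"

text \<open>Both tuples of zeros are spectra of matrices with diagonal r and constant off-diagonal
  entry, \<open>\<beta>\<close> or \<open>\<beta>'\<close>; the first matrix is the second one
  damped off the diagonal, so \<open>convex_sum_eigenvalues_le\<close> applies.\<close>

lemma shifted_step_le_distinct:
  assumes r: "inj_on r {..<n}" and \<beta>: "\<bar>\<beta>\<bar> \<le> \<bar>\<beta>'\<bar>" "\<beta> * \<beta>' \<ge> 0"
  shows "poly_spectral_le n (shifted_step \<beta> (real_rooted n r)) (shifted_step \<beta>' (real_rooted n r))"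
proof -
  have expand: "(\<Sum>l<n. (if k = l then r k else b) * p l) = (x - b) * p k"
    if "k < n" "r k * p k + b * (\<Sum>l<n. p l) = x * p k" for k b x and p :: "nat \<Rightarrow> real"
  proof -
    have "(\<Sum>l<n. (if k = l then r k else b) * p l) =
          (\<Sum>l<n. (if k = l then (r k - b) * p l else 0) + b * p l)"
      by (intro sum.cong refl) (simp add: algebra_simps)
    also have "\<dots> = (r k - b) * p k + b * (\<Sum>l<n. p l)"
      using that(1) by (simp add: sum.distrib sum_distrib_left)
    finally show ?thesis using that(2) by (simp add: algebra_simps)
  qed
  obtain x p where x: "real_rooted n r - smult (of_real \<beta>) (pderiv (real_rooted n r)) = real_rooted n x"
    "orthonormal_rows n p"
    "\<And>i k. i < n \<Longrightarrow> k < n \<Longrightarrow> r k * p i k + \<beta> * (\<Sum>l<n. p i l) = x i * p i k"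
    using diff_pderiv_eigenbasis[OF r, where \<beta> = \<beta>] by metis
  obtain y q where y: "real_rooted n r - smult (of_real \<beta>') (pderiv (real_rooted n r)) = real_rooted n y"
    "orthonormal_rows n q"
    "\<And>i k. i < n \<Longrightarrow> k < n \<Longrightarrow> r k * q i k + \<beta>' * (\<Sum>l<n. q i l) = y i * q i k"
    using diff_pderiv_eigenbasis[OF r, where \<beta> = \<beta>'] by metis
  \<comment> \<open>If \<open>\<beta>'\<close> = 0 then also \<open>\<beta>\<close> = 0, and the
    convention x / 0 = 0 makes \<open>\<theta>\<close> = 0, for which the three facts below still
    hold.\<close>
  define \<theta> where "\<theta> = \<beta> / \<beta>'"
  have \<theta>: "0 \<le> \<theta>" "\<theta> \<le> 1" "\<beta> = \<theta> * \<beta>'"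
    using \<beta> by (auto simp: \<theta>_def zero_le_mult_iff zero_le_divide_iff divide_le_eq_1 abs_if split: if_splits)
  define B where "B b k l = (if k = l then r k else b)" for b and k l :: nat
  show ?thesis
    unfolding shifted_step_def x y pcompose_shift_real_rooted poly_spectral_le_real_rooted_iff
  proof (intro allI impI)
    fix f :: "real \<Rightarrow> real" assume "convex_on UNIV f"
    then show "(\<Sum>i<n. f (x i - \<beta>)) \<le> (\<Sum>i<n. f (y i - \<beta>'))"
    proof (rule convex_sum_eigenvalues_le[OF _ \<theta>(1,2) x(2) y(2), where B = "B \<beta>" and B' = "B \<beta>'"])
      show "(\<Sum>l<n. B \<beta> k l * p i l) = (x i - \<beta>) * p i k" if "i < n" "k < n" for i k
        unfolding B_def using that x(3) by (intro expand)
      show "(\<Sum>l<n. B \<beta>' k l * q i l) = (y i - \<beta>') * q i k" if "i < n" "k < n" for i k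
        unfolding B_def using that y(3) by (intro expand)
    qed (simp add: B_def \<theta>(3))
  qed
qed

section \<open>Differential operators from power series\<close>

text \<open>The operator depends on \<open>\<phi>\<close> only through its Taylor series. Working
  with formal series turns products into compositions and reduces limits to coefficients.\<close>

definition fps_diff_op :: "complex fps \<Rightarrow> real \<Rightarrow> complex poly \<Rightarrow> complex poly" where
  "fps_diff_op F s P = (\<Sum>k\<le>degree P. smult (fps_nth F k * of_real s ^ k) ((pderiv ^^ k) P))"

lemma higher_pderiv_eq_0:
  fixes P :: "'a::{comm_semiring_1,semiring_no_zero_divisors,semiring_char_0} poly"
  shows "degree P < k \<Longrightarrow> (pderiv ^^ k) P = 0"
  by (rule poly_eqI) (simp add: coeff_higher_pderiv coeff_eq_0)

lemma smult_sum_right: "smult c (sum f A) = (\<Sum>x\<in>A. smult c (f x))"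
  by (induction A rule: infinite_finite_induct) (simp_all add: smult_add_right)

lemma fps_diff_op_eq:
  assumes "degree P \<le> n"
  shows "fps_diff_op F s P = (\<Sum>k\<le>n. smult (fps_nth F k * of_real s ^ k) ((pderiv ^^ k) P))"
  unfolding fps_diff_op_def using assms
  by (intro sum.mono_neutral_left) (auto simp: higher_pderiv_eq_0)

lemma degree_fps_diff_op: "degree (fps_diff_op F s P) \<le> degree P"
  unfolding fps_diff_op_def
  by (intro degree_sum_le order.trans[OF degree_smult_le]) (auto simp: degree_higher_pderiv)

lemma coeff_fps_diff_op:
  assumes "degree P \<le> n"
  shows "coeff (fps_diff_op F s P) i =
    (\<Sum>k\<le>n. fps_nth F k * of_real s ^ k * (pochhammer (of_nat (Suc i)) k * coeff P (i + k)))"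
  by (simp add: fps_diff_op_eq[OF assms] coeff_sum coeff_higher_pderiv)

lemma fps_diff_op_1 [simp]: "fps_diff_op 1 s P = P"
proof -
  have "fps_diff_op 1 s P = (\<Sum>k\<le>degree P. if k = 0 then P else 0)"
    unfolding fps_diff_op_def by (intro sum.cong) auto
  then show ?thesis by simp
qed

text \<open>The Cauchy product runs over the triangle i + j <= n, the composition over the full
  square; the extra terms contain derivatives of order above the degree and vanish.\<close>

lemma fps_diff_op_mult: "fps_diff_op (F * G) s P = fps_diff_op F s (fps_diff_op G s P)"
proof -
  define n where "n = degree P"
  define t where "t i j = smult (fps_nth F i * fps_nth G j * of_real s ^ (i + j)) ((pderiv ^^ (i + j)) P)" for i j
  have t0: "i + j \<le> n" if "t i j \<noteq> 0" for i j
    using that higher_pderiv_eq_0[of P "i + j"] by (force simp: t_def n_def)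
  have "fps_diff_op (F * G) s P = (\<Sum>k\<le>n. \<Sum>i\<le>k. t i (k - i))"
    unfolding fps_diff_op_def n_def[symmetric] t_def
    by (intro sum.cong refl)
       (simp add: fps_mult_nth sum_distrib_right smult_sum atLeast0AtMost)
  also have "\<dots> = (\<Sum>(i,j) | i + j \<le> n. t i j)"
    by (rule sum.triangle_reindex_eq[symmetric])
  also have "\<dots> = (\<Sum>(i,j) \<in> {..n} \<times> {..n}. t i j)"
    by (intro sum.mono_neutral_left) (auto dest: t0)
  also have "\<dots> = (\<Sum>i\<le>n. \<Sum>j\<le>n. t i j)"
    by (simp add: sum.cartesian_product)
  also have "\<dots> = (\<Sum>i\<le>n. smult (fps_nth F i * of_real s ^ i) ((pderiv ^^ i) (fps_diff_op G s P)))"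
    unfolding fps_diff_op_def n_def[symmetric] t_def higher_pderiv_sum higher_pderiv_smult smult_sum_right
    by (intro sum.cong refl) (simp add: funpow_add power_add mult_ac)
  also have "\<dots> = fps_diff_op F s (fps_diff_op G s P)"
    by (rule fps_diff_op_eq[symmetric]) (simp add: degree_fps_diff_op n_def)
  finally show ?thesis .
qed

text \<open>The parameters s and t may differ, so commutativity of series does not give this; what
  is used is that powers of D commute.\<close>

lemma fps_diff_op_commute: "fps_diff_op F s (fps_diff_op G t P) = fps_diff_op G t (fps_diff_op F s P)"
proof -
  define n where "n = degree P"
  have n: "degree P \<le> n" "degree (fps_diff_op F s P) \<le> n" "degree (fps_diff_op G t P) \<le> n"
    using degree_fps_diff_op by (simp_all add: n_def)
  show ?thesis
    unfolding fps_diff_op_eq[OF n(2)] fps_diff_op_eq[OF n(3)]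
    unfolding fps_diff_op_eq[OF n(1)] higher_pderiv_sum higher_pderiv_smult smult_sum_right
    by (subst sum.swap) (simp add: mult_ac add.commute flip: funpow_add comp_apply[of "pderiv ^^ _" "pderiv ^^ _"])
qed

lemma tendsto_coeff_fps_diff_op:
  assumes "\<And>k. (\<lambda>N. fps_nth (F N) k) \<longlonglongrightarrow> fps_nth G k"
  shows "(\<lambda>N. coeff (fps_diff_op (F N) s P) i) \<longlonglongrightarrow> coeff (fps_diff_op G s P) i"
  unfolding coeff_fps_diff_op[OF order.refl] by (intro tendsto_intros assms)

lemma tendsto_coeff_fps_diff_op_poly:
  assumes "\<And>N. degree (P N) \<le> n" "degree Q \<le> n"
    and "\<And>k. (\<lambda>N. coeff (P N) k) \<longlonglongrightarrow> coeff Q k"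
  shows "(\<lambda>N. coeff (fps_diff_op F s (P N)) i) \<longlonglongrightarrow> coeff (fps_diff_op F s Q) i"
  unfolding coeff_fps_diff_op[OF assms(1)] coeff_fps_diff_op[OF assms(2)] by (intro tendsto_intros assms(3))

text \<open>The Leibniz rule for multiplication by x. At k = 0 the truncated \<open>k - 1\<close>
  does no harm, as its coefficient is 0.\<close>

lemma higher_pderiv_pCons_0:
  "(pderiv ^^ k) (pCons 0 P) = pCons 0 ((pderiv ^^ k) P) + smult (of_nat k) ((pderiv ^^ (k - 1)) P)"
  for P :: "'a::idom poly"
proof (induction k)
  case (Suc k)
  then show ?case
    using smult_add_left[of 1 1 "(pderiv ^^ k) P"]
    by (cases k) (simp_all add: pderiv_add pderiv_pCons pderiv_smult smult_add_left)
qed simp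

text \<open>Taylor's formula exp(h D) P = P(x + h). Writing the polynomial as a + x Q, the Leibniz
  rule turns the sum for x Q into (x + h) times the sum for Q.\<close>

lemma taylor_pcompose:
  fixes P :: "'a::field_char_0 poly"
  assumes "degree P \<le> n"
  shows "(\<Sum>k\<le>n. smult (h ^ k / fact k) ((pderiv ^^ k) P)) = pcompose P [:h, 1:]"
  using assms
proof (induction P arbitrary: n)
  case 0
  then show ?case by simp
next
  case (pCons a P)
  show ?case
  proof (cases "P = 0")
    case True
    have "(\<Sum>k\<le>n. smult (h ^ k / fact k) ((pderiv ^^ k) [:a:])) = (\<Sum>k\<le>n. if k = 0 then [:a:] else 0)"
      by (intro sum.cong) (auto simp: higher_pderiv_eq_0)
    then show ?thesis using True by simp
  next
    case False
    then obtain m where m: "n = Suc m" "degree P \<le> m"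
      using pCons.prems by (cases n) auto
    let ?T = "\<Sum>k\<le>m. smult (h ^ k / fact k) ((pderiv ^^ k) P)"
    have "(\<Sum>k\<le>n. smult (h ^ k / fact k) ((pderiv ^^ k) (pCons a P))) =
      (\<Sum>k\<le>n. smult (h ^ k / fact k) ((pderiv ^^ k) [:a:])) +
      (\<Sum>k\<le>n. smult (h ^ k / fact k) ((pderiv ^^ k) (pCons 0 P)))"
      by (simp flip: sum.distrib smult_add_right higher_pderiv_add)
    also have "(\<Sum>k\<le>n. smult (h ^ k / fact k) ((pderiv ^^ k) [:a:])) = (\<Sum>k\<le>n. if k = 0 then [:a:] else 0)"
      by (intro sum.cong) (auto simp: higher_pderiv_eq_0)
    also have "\<dots> = [:a:]" by simp
    also have "(\<Sum>k\<le>n. smult (h ^ k / fact k) ((pderiv ^^ k) (pCons 0 P))) =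
       [:0, 1:] * (\<Sum>k\<le>n. smult (h ^ k / fact k) ((pderiv ^^ k) P)) +
       (\<Sum>k\<le>n. smult (h ^ k / fact k) (smult (of_nat k) ((pderiv ^^ (k - 1)) P)))"
      by (simp add: higher_pderiv_pCons_0 smult_add_right sum.distrib sum_distrib_left del: smult_smult)
    also have "(\<Sum>k\<le>n. smult (h ^ k / fact k) ((pderiv ^^ k) P)) = ?T"
      using m by (simp add: higher_pderiv_eq_0 del: funpow.simps)
    also have "(\<Sum>k\<le>n. smult (h ^ k / fact k) (smult (of_nat k) ((pderiv ^^ (k - 1)) P))) = smult h ?T"
      unfolding m(1) sum.atMost_Suc_shift
      by (simp add: smult_sum_right field_simps del: of_nat_Suc)
    also have "[:a:] + ([:0, 1:] * ?T + smult h ?T) = [:a:] + [:h, 1:] * ?T"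
      by (simp add: algebra_simps)
    finally show ?thesis by (simp add: pcompose_pCons pCons.IH[OF m(2)])
  qed
qed

lemma fps_diff_op_exp: "fps_diff_op (fps_exp (of_real \<alpha>)) s P = pcompose P [:of_real (\<alpha> * s), 1:]"
  unfolding fps_diff_op_def
  by (subst taylor_pcompose[OF order.refl, symmetric]) (simp add: power_mult_distrib field_simps)

lemma fps_diff_op_linear:
  "fps_diff_op (1 - fps_const (of_real \<alpha>) * fps_X) s P = P - smult (of_real (\<alpha> * s)) (pderiv P)"
proof -
  \<comment> \<open>The range is extended by one so that the index k = 1 occurs even for a constant
    P.\<close>
  have "fps_diff_op (1 - fps_const (of_real \<alpha>) * fps_X) s P =
        (\<Sum>k\<le>Suc (degree P). (if k = 0 then P else 0) +
           (if k = 1 then - smult (of_real (\<alpha> * s)) (pderiv P) else 0))"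
    by (subst fps_diff_op_eq[of _ "Suc (degree P)"]) (auto intro!: sum.cong simp: fps_X_def)
  also have "\<dots> = P - smult (of_real (\<alpha> * s)) (pderiv P)"
    by (simp add: sum.distrib del: sum.atMost_Suc)
  finally show ?thesis .
qed

text \<open>The exponential is the left factor so that the translation is applied last, as in
  \<open>shifted_step\<close>.\<close>

definition genus_one_fps :: "real \<Rightarrow> complex fps" where
  "genus_one_fps \<alpha> = fps_exp (of_real \<alpha>) * (1 - fps_const (of_real \<alpha>) * fps_X)"

lemma fps_diff_op_genus_one: "fps_diff_op (genus_one_fps \<alpha>) s P = shifted_step (\<alpha> * s) P"
  by (simp add: genus_one_fps_def fps_diff_op_mult fps_diff_op_exp fps_diff_op_linear shifted_step_def)

section \<open>Series whose operators are monotone in the parameter, and their closure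
  properties\<close>

definition spectral_monotone :: "complex fps \<Rightarrow> bool" where
  "spectral_monotone F \<longleftrightarrow>
     (\<forall>n s t. \<forall>P\<in>hyperbolic_polys n. \<bar>s\<bar> \<le> \<bar>t\<bar> \<longrightarrow> s * t \<ge> 0 \<longrightarrow>
        poly_spectral_le n (fps_diff_op F s P) (fps_diff_op F t P))"

lemma spectral_monotone_1: "spectral_monotone 1"
  by (simp add: spectral_monotone_def poly_spectral_le_refl)

lemma tendsto_coeff_real_rooted:
  assumes "\<And>i. i < n \<Longrightarrow> (\<lambda>N. x N i) \<longlonglongrightarrow> l i"
  shows "(\<lambda>N. coeff (real_rooted n (x N)) k) \<longlonglongrightarrow> coeff (real_rooted n l) k"
  using assms
proof (induction n arbitrary: k)
  case (Suc n)
  have eq: "coeff (real_rooted (Suc n) r) k =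
      (case k of 0 \<Rightarrow> 0 | Suc j \<Rightarrow> coeff (real_rooted n r) j) - of_real (r n) * coeff (real_rooted n r) k" for r
    by (simp add: real_rooted_def coeff_pCons split: nat.split)
  have IH: "(\<lambda>N. coeff (real_rooted n (x N)) j) \<longlonglongrightarrow> coeff (real_rooted n l) j" for j
    using Suc by simp
  show ?case
    unfolding eq using Suc.prems by (cases k) (auto intro!: tendsto_intros IH)
qed (simp add: real_rooted_def)

text \<open>Multiple zeros are separated by replacing the k-th smallest zero r k by r k + k / (N + 1).\<close>
lemma spectral_monotone_genus_one: "spectral_monotone (genus_one_fps \<alpha>)"
  unfolding spectral_monotone_def
proof (intro allI ballI impI)
  fix n and s t :: real and P assume P: "P \<in> hyperbolic_polys n" and st: "\<bar>s\<bar> \<le> \<bar>t\<bar>" "s * t \<ge> 0"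
  obtain r where r: "P = real_rooted n r" "\<forall>i j. i \<le> j \<longrightarrow> j < n \<longrightarrow> r i \<le> r j"
    using hyperbolic_sorted_roots[OF P] .
  define x where "x N k = r k + real k / real (Suc N)" for N k
  have less: "x N i < x N j" if "i < j" "j < n" for N i j
    unfolding x_def using r(2) that by (intro add_le_less_mono divide_strict_right_mono) auto
  have inj: "inj_on (x N) {..<n}" for N
    unfolding inj_on_def by (metis less lessThan_iff linorder_neqE_nat order_less_irrefl)
  have "(\<lambda>N. x N k) \<longlonglongrightarrow> r k" for k
  proof -
    have "(\<lambda>N. r k + real k / real (Suc N)) \<longlonglongrightarrow> r k + 0"
      by (intro tendsto_intros LIMSEQ_Suc[OF lim_const_over_n])
    then show ?thesis by (simp add: x_def)
  qed
  then have lim: "(\<lambda>N. coeff (real_rooted n (x N)) k) \<longlonglongrightarrow> coeff P k" for k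
    unfolding r(1) by (intro tendsto_coeff_real_rooted) auto
  have deg: "degree P \<le> n" by (simp add: r(1))
  have ab: "\<bar>\<alpha> * s\<bar> \<le> \<bar>\<alpha> * t\<bar>" "(\<alpha> * s) * (\<alpha> * t) \<ge> 0"
  proof -
    show "\<bar>\<alpha> * s\<bar> \<le> \<bar>\<alpha> * t\<bar>" using st(1) by (simp add: abs_mult mult_left_mono)
    have "(\<alpha> * s) * (\<alpha> * t) = \<alpha>\<^sup>2 * (s * t)" by (simp add: power2_eq_square)
    then show "(\<alpha> * s) * (\<alpha> * t) \<ge> 0" using st(2) by (metis mult_nonneg_nonneg zero_le_power2)
  qed
  show "poly_spectral_le n (fps_diff_op (genus_one_fps \<alpha>) s P) (fps_diff_op (genus_one_fps \<alpha>) t P)"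
  proof (rule poly_spectral_le_limit)
    show "poly_spectral_le n (fps_diff_op (genus_one_fps \<alpha>) s (real_rooted n (x N)))
        (fps_diff_op (genus_one_fps \<alpha>) t (real_rooted n (x N)))" for N
      unfolding fps_diff_op_genus_one by (rule shifted_step_le_distinct[OF inj ab])
  qed (auto intro!: tendsto_coeff_fps_diff_op_poly[of _ n] lim deg)
qed

text \<open>Pass through the polynomial with F at t and G at s. After commuting, each half changes
  the parameter of one factor only, acting on a polynomial that is again hyperbolic because the
  order includes membership.\<close>

lemma spectral_monotone_mult:
  assumes F: "spectral_monotone F" and G: "spectral_monotone G"
  shows "spectral_monotone (F * G)"
  unfolding spectral_monotone_def
proof (intro allI ballI impI)
  fix n and s t :: real and P assume P: "P \<in> hyperbolic_polys n" and st: "\<bar>s\<bar> \<le> \<bar>t\<bar>" "s * t \<ge> 0"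
  have le: "poly_spectral_le n (fps_diff_op H s Q) (fps_diff_op H t Q)"
    if "spectral_monotone H" "Q \<in> hyperbolic_polys n" for H Q
    using that st by (simp add: spectral_monotone_def)
  have "fps_diff_op G s P \<in> hyperbolic_polys n" "fps_diff_op F t P \<in> hyperbolic_polys n"
    using le[OF G P] le[OF F P] by (simp_all add: poly_spectral_le_def)
  then have "poly_spectral_le n (fps_diff_op F s (fps_diff_op G s P)) (fps_diff_op F t (fps_diff_op G s P))"
    "poly_spectral_le n (fps_diff_op G s (fps_diff_op F t P)) (fps_diff_op G t (fps_diff_op F t P))"
    using le F G by blast+
  then show "poly_spectral_le n (fps_diff_op (F * G) s P) (fps_diff_op (F * G) t P)"
    unfolding fps_diff_op_mult fps_diff_op_commute[of G _ F] by (rule poly_spectral_le_trans)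
qed

lemma spectral_monotone_power: "spectral_monotone F \<Longrightarrow> spectral_monotone (F ^ N)"
  by (induction N) (simp_all add: spectral_monotone_1 spectral_monotone_mult)

lemma spectral_monotone_prod: "(\<And>k. k \<in> A \<Longrightarrow> spectral_monotone (F k)) \<Longrightarrow> spectral_monotone (\<Prod>k\<in>A. F k)"
  by (induction A rule: infinite_finite_induct) (simp_all add: spectral_monotone_1 spectral_monotone_mult)

lemma spectral_monotone_limit:
  assumes "\<And>N. spectral_monotone (F N)" "\<And>k. (\<lambda>N. fps_nth (F N) k) \<longlonglongrightarrow> fps_nth G k"
  shows "spectral_monotone G"
  unfolding spectral_monotone_def
proof (intro allI ballI impI)
  fix n and s t :: real and P assume "P \<in> hyperbolic_polys n" "\<bar>s\<bar> \<le> \<bar>t\<bar>" "s * t \<ge> 0"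
  then show "poly_spectral_le n (fps_diff_op G s P) (fps_diff_op G t P)"
    using assms(1) unfolding spectral_monotone_def
    by (intro poly_spectral_le_limit[OF _ tendsto_coeff_fps_diff_op tendsto_coeff_fps_diff_op, OF _ assms(2,2)]) blast
qed

section \<open>Passage to the Laguerre-Polya class\<close>

text \<open>Locally uniform convergence of holomorphic functions carries over to all derivatives at
  0, hence to every Taylor coefficient. A disc around 0 is enough for this.\<close>

lemma spectral_monotone_uniform_limit:
  assumes F: "\<And>N. f N has_fps_expansion F N" "\<And>N. spectral_monotone (F N)"
    and f: "\<And>N. f N holomorphic_on ball 0 1"
    and lim: "uniform_limit (ball 0 1) f g sequentially"
  shows "spectral_monotone (fps_expansion g 0)"
proof (rule spectral_monotone_limit[of F])
  fix k
  have "(\<lambda>N. (deriv ^^ k) (f N) 0) \<longlonglongrightarrow> (deriv ^^ k) g 0"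
    by (rule higher_deriv_complex_uniform_limit[OF lim]) (auto simp: f)
  then show "(\<lambda>N. fps_nth (F N) k) \<longlonglongrightarrow> fps_nth (fps_expansion g 0) k"
    unfolding fps_nth_fps_expansion[OF F(1)] by (simp add: fps_expansion_def tendsto_divide)
qed (rule F(2))

lemma genus_one_has_fps_expansion:
  "(\<lambda>z. (1 - of_real \<alpha> * z) * exp (of_real \<alpha> * z)) has_fps_expansion genus_one_fps \<alpha>"
proof -
  have "(\<lambda>z. exp (of_real \<alpha> * z) * (1 - of_real \<alpha> * z)) has_fps_expansion genus_one_fps \<alpha>"
    unfolding genus_one_fps_def by (intro fps_expansion_intros)
  then show ?thesis by (simp add: mult.commute)
qed

text \<open>Put m = N + 1 and w = -c z^2 / m. Then 1 + w and exp w differ by O(1 / m^2), and raising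
  both to the power m costs only a factor of order m, so the error is O(1 / m) uniformly in
  z.\<close>

lemma exp_limit_uniform:
  "uniform_limit (ball 0 1) (\<lambda>N z. (1 - of_real (c / real (Suc N)) * z\<^sup>2) ^ Suc N)
     (\<lambda>z. exp (- (of_real c * z\<^sup>2)) :: complex) sequentially"
proof (rule uniform_limitI)
  fix e :: real assume e: "e > 0"
  \<comment> \<open>One factor exp |c| undoes the scaling of A and B below, the other comes from the
    Taylor remainder; |c|^2 / m is m h^2.\<close>
  define K where "K = exp \<bar>c\<bar> * (exp \<bar>c\<bar> * \<bar>c\<bar>\<^sup>2)"
  have bound: "norm ((1 - of_real (c / real (Suc N)) * z\<^sup>2) ^ Suc N - exp (- (of_real c * z\<^sup>2))) \<le> K / real (Suc N)"
    if z: "norm z < 1" for z :: complex and N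
  proof -
    define m where "m = Suc N"
    have "real m > 0" by (simp add: m_def)
    define w where "w = - (of_real (c / real m) * z\<^sup>2)"
    define h where "h = \<bar>c\<bar> / real m"
    have "norm z ^ 2 \<le> 1" using z by (intro power_le_one) auto
    then have w: "norm w \<le> h"
      by (simp add: w_def h_def norm_mult norm_divide norm_power mult_left_le divide_right_mono)
    have h: "0 \<le> h" "h \<le> \<bar>c\<bar>"
      by (simp_all add: h_def m_def divide_le_eq mult_le_cancel_left1)
    have scale: "norm (of_real (exp (- h)) * u) \<le> 1" if "norm u \<le> exp h" for u :: complex
      using mult_left_mono[OF that, of "exp (- h)"] by (simp add: norm_mult flip: exp_add)
    \<comment> \<open>Scaling by exp(-h) brings both bases into the closed unit disc, where the m-th
      powers differ by at most m times the difference of the bases. Over m factors the scaling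
      amounts to exp(-|c|), whatever m is.\<close>
    define A where "A = of_real (exp (- h)) * (1 + w)"
    define B where "B = of_real (exp (- h)) * exp w"
    have "norm (1 + w) \<le> exp h"
      using norm_triangle_ineq[of 1 w] w exp_ge_add_one_self[of h] by (simp only: norm_one)
    then have A: "norm A \<le> 1"
      unfolding A_def by (rule scale)
    have "norm (exp w) \<le> exp h" using norm_exp[of w] w by (meson exp_le_cancel_iff order.trans)
    then have B: "norm B \<le> 1"
      unfolding B_def by (rule scale)
    have "norm (exp w - (1 + w)) \<le> exp (norm w) * norm w ^ 2"
      using Taylor_exp_field[of w 1] by (simp add: numeral_2_eq_2)
    also have "\<dots> \<le> exp \<bar>c\<bar> * h ^ 2"
      using w h by (intro mult_mono power_mono) auto
    finally have "norm ((1 + w) - exp w) \<le> exp \<bar>c\<bar> * h ^ 2" by (simp add: norm_minus_commute)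
    moreover have "norm (A - B) \<le> norm ((1 + w) - exp w)"
      using h by (simp add: A_def B_def norm_mult mult_left_le_one_le flip: right_diff_distrib)
    ultimately have AB: "norm (A - B) \<le> exp \<bar>c\<bar> * h ^ 2" by linarith
    have pow: "of_real (exp (- h)) ^ m = complex_of_real (exp (- \<bar>c\<bar>))"
    proof -
      have "real m * (- h) = - \<bar>c\<bar>" by (simp add: h_def m_def)
      then show ?thesis by (metis exp_of_nat_mult of_real_power)
    qed
    have ex: "exp w ^ m = exp (- (of_real c * z\<^sup>2))"
    proof -
      have "of_nat m * w = - (of_real c * z\<^sup>2)" by (simp add: w_def m_def field_simps del: of_nat_Suc)
      then show ?thesis by (metis exp_of_nat_mult)
    qed
    have "(1 + w) ^ m - exp w ^ m = of_real (exp \<bar>c\<bar>) * (A ^ m - B ^ m)"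
      unfolding A_def B_def power_mult_distrib pow
      by (simp add: exp_minus algebra_simps)
    then have "norm ((1 + w) ^ m - exp w ^ m) = exp \<bar>c\<bar> * norm (A ^ m - B ^ m)"
      by (simp add: norm_mult)
    also have "\<dots> \<le> exp \<bar>c\<bar> * (real m * (exp \<bar>c\<bar> * h ^ 2))"
      by (intro mult_left_mono order.trans[OF norm_power_diff[OF A B]] AB) auto
    also have "\<dots> = K / real m"
      using \<open>real m > 0\<close> by (simp add: K_def h_def power2_eq_square field_simps)
    finally show ?thesis by (simp add: ex m_def[symmetric]) (simp add: w_def)
  qed
  have "(\<lambda>N. K / real (Suc N)) \<longlonglongrightarrow> 0"
    by (rule LIMSEQ_Suc[OF lim_const_over_n])
  then have "eventually (\<lambda>N. K / real (Suc N) < e) sequentially"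
    using e by (rule order_tendstoD)
  then show "\<forall>\<^sub>F N in sequentially. \<forall>z\<in>ball 0 1.
      dist ((1 - of_real (c / real (Suc N)) * z\<^sup>2) ^ Suc N) (exp (- (of_real c * z\<^sup>2)) :: complex) < e"
  proof eventually_elim
    case (elim N)
    then show ?case using bound[of _ N] by (force simp: dist_norm)
  qed
qed

text \<open>Each 1 - a^2 z^2 / (N + 1) is the product of the genus-one factors with parameters b and
  -b, where b = a / sqrt (N + 1): their exponentials cancel. That b is real rests on the sign of the
  Gaussian exponent.\<close>

lemma spectral_monotone_gaussian:
  "spectral_monotone (fps_expansion (\<lambda>z. exp (- (of_real (a\<^sup>2) * z\<^sup>2))) 0)"
proof (rule spectral_monotone_uniform_limit[OF _ _ _ exp_limit_uniform])
  fix N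
  define b where "b = a / sqrt (real (Suc N))"
  let ?g = "\<lambda>\<alpha> z. (1 - complex_of_real \<alpha> * z) * exp (of_real \<alpha> * z)"
  have b2: "b\<^sup>2 = a\<^sup>2 / real (Suc N)" by (simp add: b_def power_divide)
  have "?g b z * ?g (- b) z = 1 - of_real (a\<^sup>2 / real (Suc N)) * z\<^sup>2" for z
  proof -
    have "?g b z * ?g (- b) z = (1 - of_real (b\<^sup>2) * z\<^sup>2) * (exp (of_real b * z) * exp (- (of_real b * z)))"
      by (simp add: algebra_simps power2_eq_square)
    then show ?thesis by (simp add: b2 flip: exp_add)
  qed
  moreover have "(\<lambda>z. (?g b z * ?g (- b) z) ^ Suc N) has_fps_expansion
      (genus_one_fps b * genus_one_fps (- b)) ^ Suc N"
    by (intro has_fps_expansion_power has_fps_expansion_mult genus_one_has_fps_expansion)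
  ultimately show "(\<lambda>z. (1 - of_real (a\<^sup>2 / real (Suc N)) * z\<^sup>2) ^ Suc N) has_fps_expansion
      (genus_one_fps (a / sqrt (real (Suc N))) * genus_one_fps (- (a / sqrt (real (Suc N))))) ^ Suc N"
    by (simp add: b_def)
qed (intro spectral_monotone_power spectral_monotone_mult spectral_monotone_genus_one holomorphic_intros)+

text \<open>The exponential cancels the linear term of 1 - alpha z, so for small alpha the factor
  differs from 1 only by a multiple of alpha^2, and square summability suffices for uniform
  convergence.\<close>

lemma genus_one_product_uniform_limit:
  assumes \<alpha>: "summable (\<lambda>k. (\<alpha> k)\<^sup>2)"
  shows "uniform_limit (cball 0 1) (\<lambda>N z. \<Prod>k<N. (1 - of_real (\<alpha> k) * z) * exp (of_real (\<alpha> k) * z))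
           (\<lambda>z. \<Prod>k. (1 - of_real (\<alpha> k) * z) * exp (of_real (\<alpha> k) * z) :: complex) sequentially"
proof -
  define f where "f k z = (1 - of_real (\<alpha> k) * z) * exp (of_real (\<alpha> k) * z)" for k and z :: complex
  have fw: "f k z = weierstrass_factor 1 (of_real (\<alpha> k) * z)" for k z
    by (simp add: f_def weierstrass_factor_def)
  have "(\<lambda>k. (\<alpha> k)\<^sup>2) \<longlonglongrightarrow> 0" by (rule summable_LIMSEQ_zero[OF \<alpha>])
  \<comment> \<open>The bound for Weierstrass factors requires an argument of norm at most 1/2,
    hence the threshold 1/4 for the square.\<close>
  then have "eventually (\<lambda>k. (\<alpha> k)\<^sup>2 < 1 / 4) sequentially"
    by (rule order_tendstoD) simp
  then have bound: "eventually (\<lambda>k. \<forall>z\<in>cball 0 1. norm (f k z - 1) \<le> 3 * (\<alpha> k)\<^sup>2) sequentially"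
  proof eventually_elim
    case (elim k)
    then have a: "\<bar>\<alpha> k\<bar> \<le> 1 / 2"
      using abs_le_square_iff[of "\<alpha> k" "1/2"] by (simp add: power2_eq_square)
    show ?case
    proof
      fix z :: complex assume "z \<in> cball 0 1"
      then have z: "norm (of_real (\<alpha> k) * z) \<le> \<bar>\<alpha> k\<bar>"
        by (simp add: norm_mult mult_left_le)
      then have "norm (f k z - 1) \<le> 3 * norm (of_real (\<alpha> k) * z) ^ 2"
        using weierstrass_factor_bound[of "of_real (\<alpha> k) * z" 1] a by (simp add: fw numeral_2_eq_2)
      also have "\<dots> \<le> 3 * (\<alpha> k)\<^sup>2"
        using power_mono[OF z, of 2] by simp
      finally show "norm (f k z - 1) \<le> 3 * (\<alpha> k)\<^sup>2" .
    qed
  qed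
  have "uniformly_convergent_on (cball 0 1) (\<lambda>N z. \<Sum>k<N. norm (f k z - 1))"
    by (rule Weierstrass_m_test'_ev[where M = "\<lambda>k. 3 * (\<alpha> k)\<^sup>2"])
       (use bound \<alpha> in \<open>auto intro: summable_mult\<close>)
  then have "uniformly_convergent_on (cball 0 1) (\<lambda>N z. \<Prod>k<N. f k z)"
    by (intro uniformly_convergent_on_prod') (auto simp: f_def intro!: continuous_intros)
  then obtain L where L: "uniform_limit (cball 0 1) (\<lambda>N z. \<Prod>k<N. f k z) L sequentially"
    by (auto simp: uniformly_convergent_on_def)
  \<comment> \<open>The infinite product is identified with the limit of its partial products
    through \<open>convergent_prod\<close>, which tolerates finitely many vanishing factors, as
    happens at z = 1 / \<open>\<alpha> k\<close>.\<close>
  have "L z = (\<Prod>k. f k z)" if z: "z \<in> cball 0 1" for z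
  proof (rule LIMSEQ_unique)
    show "(\<lambda>N. \<Prod>k<N. f k z) \<longlonglongrightarrow> L z" by (rule tendsto_uniform_limitI[OF L z])
    have "summable (\<lambda>k. norm (f k z - 1))"
      by (rule summable_comparison_test_ev[of _ "\<lambda>k. 3 * (\<alpha> k)\<^sup>2"])
         (use bound z \<alpha> in \<open>auto elim!: eventually_mono intro: summable_mult\<close>)
    then have "convergent_prod (\<lambda>k. f k z)"
      by (intro abs_convergent_prod_imp_convergent_prod summable_imp_abs_convergent_prod)
    then show "(\<lambda>N. \<Prod>k<N. f k z) \<longlonglongrightarrow> (\<Prod>k. f k z)"
      by (simp add: LIMSEQ_lessThan_iff_atMost convergent_prod_LIMSEQ)
  qed
  with L have "uniform_limit (cball 0 1) (\<lambda>N z. \<Prod>k<N. f k z) (\<lambda>z. \<Prod>k. f k z) sequentially"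
    by (simp add: uniform_limit_iff)
  then show ?thesis by (simp only: f_def)
qed

lemma spectral_monotone_LP':
  assumes "\<phi> \<in> LP'" "\<phi> 0 = 1"
  shows "spectral_monotone (fps_expansion \<phi> 0)"
proof -
  from assms(1) obtain a c m \<alpha> where c: "c \<noteq> 0" and \<alpha>: "summable (\<lambda>k. (\<alpha> k)\<^sup>2)"
    and \<phi>: "\<And>z. \<phi> z = of_real c * z ^ m * exp (- (of_real (a\<^sup>2) * z\<^sup>2)) *
               (\<Prod>k. (1 - of_real (\<alpha> k) * z) * exp (of_real (\<alpha> k) * z))"
    unfolding LP'_def by blast
  define f where "f k z = (1 - of_real (\<alpha> k) * z) * exp (of_real (\<alpha> k) * z)" for k and z :: complex
  define g where "g z = (\<Prod>k. f k z)" for z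
  define G where "G z = exp (- (of_real (a\<^sup>2) * z\<^sup>2))" for z :: complex
  \<comment> \<open>At 0 the Gaussian and every genus-one factor equal 1, so the normalization
    leaves c 0^m = 1 and excludes m > 0.\<close>
  have "of_real c * (0::complex) ^ m = 1"
    using assms(2) \<phi>[of 0] by simp
  then have m: "m = 0" "c = 1" by (cases m; simp)+
  have \<phi>': "\<phi> = (\<lambda>z. G z * g z)" by (rule ext) (simp add: \<phi> m G_def g_def f_def)
  have lim: "uniform_limit (cball 0 1) (\<lambda>N z. \<Prod>k<N. f k z) g sequentially"
    using genus_one_product_uniform_limit[OF \<alpha>] unfolding f_def g_def .
  \<comment> \<open>Convergence is at hand on the unit disc only, which is enough for the Taylor
    series of g at 0; by uniqueness the series of \<open>\<phi>\<close> is then the product of those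
    of G and g.\<close>
  have "g holomorphic_on ball 0 1"
  proof (rule holomorphic_uniform_limit[OF _ lim])
    show "\<forall>\<^sub>F N in sequentially. continuous_on (cball 0 1) (\<lambda>z. \<Prod>k<N. f k z) \<and>
        (\<lambda>z. \<Prod>k<N. f k z) holomorphic_on ball 0 1"
      by (intro always_eventually allI conjI; unfold f_def; intro continuous_intros holomorphic_intros)
  qed auto
  then have g: "g has_fps_expansion fps_expansion g 0"
    by (intro has_fps_expansion_fps_expansion[of "ball 0 1"]) auto
  have G: "G has_fps_expansion fps_expansion G 0"
    unfolding G_def by (intro has_fps_expansion_fps_expansion[of UNIV] holomorphic_intros) auto
  have "\<phi> has_fps_expansion fps_expansion \<phi> 0"
    using assms(1) by (intro has_fps_expansion_fps_expansion[of UNIV]) (auto simp: LP'_def)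
  moreover have "\<phi> has_fps_expansion fps_expansion G 0 * fps_expansion g 0"
    unfolding \<phi>' by (rule has_fps_expansion_mult[OF G g])
  ultimately have "fps_expansion \<phi> 0 = fps_expansion G 0 * fps_expansion g 0"
    by (rule fps_expansion_unique_complex)
  moreover have "spectral_monotone (fps_expansion G 0)"
    unfolding G_def by (rule spectral_monotone_gaussian)
  moreover have "spectral_monotone (fps_expansion g 0)"
  proof (rule spectral_monotone_uniform_limit)
    show "(\<lambda>z. \<Prod>k<N. f k z) has_fps_expansion (\<Prod>k<N. genus_one_fps (\<alpha> k))" for N
      unfolding f_def by (intro has_fps_expansion_prod genus_one_has_fps_expansion)
    show "spectral_monotone (\<Prod>k<N. genus_one_fps (\<alpha> k))" for N
      by (intro spectral_monotone_prod spectral_monotone_genus_one)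
    show "(\<lambda>z. \<Prod>k<N. f k z) holomorphic_on ball 0 1" for N
      unfolding f_def by (intro holomorphic_intros)
    show "uniform_limit (ball 0 1) (\<lambda>N z. \<Prod>k<N. f k z) g sequentially"
      using lim by (rule uniform_limit_on_subset) auto
  qed
  ultimately show ?thesis by (simp add: spectral_monotone_mult)
qed

theorem corollary7:
  fixes n :: nat and \<phi> :: "complex \<Rightarrow> complex" and s t :: real
  assumes "n \<ge> 1"
    and "\<phi> \<in> LP'" and "\<phi> 0 = 1"
    and "\<bar>s\<bar> \<le> \<bar>t\<bar>" and "s * t \<ge> 0"
  shows "\<forall>P \<in> hyperbolic_polys n. poly_spectral_le n (diff_op \<phi> s P) (diff_op \<phi> t P)"
proof -
  have "diff_op \<phi> u P = fps_diff_op (fps_expansion \<phi> 0) u P" for u P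
    by (simp add: diff_op_def fps_diff_op_def)
  then show ?thesis
    using spectral_monotone_LP'[OF assms(2,3)] assms(4,5) by (simp add: spectral_monotone_def)
qed

end
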